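(* Let $F(s)=\sum_{n=1}^{N} a_n n^{-s}$ be a Dirichlet polynomial with complex coefficients $a_1,\dots,a_N$. Then, whenever $0<q\le 2$, $$\left(\sum_{n=1}^{N}|\mu(n)|\,|a_n|^2\,[d(n)]^{\frac{\log q}{\log 2}-1}\right)^{1/2}\le \|F\|_q .$$
   Context: For $0<q<\infty$, the $L^q$ norm of a Dirichlet polynomial $F(s)=\sum_{n=1}^N a_n n^{-s}$ is $$\|F\|_q:=\left(\lim_{T\to\infty}\frac1T\int_0^T|F(it)|^q\,dt\right)^{1/q}.$$ $\mu$ is the Möbius function and $d(n)$ is the number of positive divisors of $n$. *)

theory Defs
  imports "HOL-Analysis.Analysis" "HOL-Computational_Algebra.Computational_Algebra"
begin

definition moebius_mu :: "nat \<Rightarrow> int" where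
  "moebius_mu n = (if squarefree n then (- 1) ^ card (prime_factors n) else 0)"

definition num_divisors :: "nat \<Rightarrow> nat" where
  "num_divisors n = card {d. d dvd n}"

definition dirichlet_poly :: "(nat \<Rightarrow> complex) \<Rightarrow> nat \<Rightarrow> complex \<Rightarrow> complex" where
  "dirichlet_poly a N s = (\<Sum>n = 1..N. a n * of_nat n powr (- s))"

text \<open>\<open>Lim\<close> is a definite description, so the value is meaningful only where the limit
  exists. For Dirichlet polynomials and \<open>q > 0\<close> it does, but this is not built into the
  definition.\<close>

definition Lq_norm :: "real \<Rightarrow> (complex \<Rightarrow> complex) \<Rightarrow> real" where
  "Lq_norm q F =
     (Lim at_top (\<lambda>T. (1 / T) * integral {0..T} (\<lambda>t. norm (F (\<i> * of_real t)) powr q)))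
       powr (1 / q)"

end

theory Submission
  imports Defs "HOL-Complex_Analysis.Cauchy_Integral_Formula"
begin

text \<open>
  Write \<open>s = q/2\<close>. For squarefree \<open>n\<close> with \<open>\<omega>(n)\<close> prime factors, \<open>d(n) = 2^\<omega>(n)\<close>, so the weight
  \<open>d(n)^(log q / log 2 - 1)\<close> is \<open>s^\<omega>(n)\<close>: each prime dividing \<open>n\<close> contributes one factor \<open>s\<close>, and
  the inequality can be proved one prime at a time.

  For a single variable the claim is a part of Weissler's contractive inequality: a polynomial
  \<open>f\<close> with coefficients \<open>c\<^sub>0, c\<^sub>1, \<dots>\<close> satisfies \<open>|c\<^sub>0|^2 + s |c\<^sub>1|^2 \<le> \<parallel>f\<parallel>\<^sub>q^2\<close> on the unit circle
  (\<open>weissler_coeff_bound\<close>). If \<open>f\<close> has no zero in the open disc, then \<open>g = f^s\<close> is holomorphic there,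
  Bessel's inequality bounds \<open>|g(0)|^2 + |g'(0)|^2\<close> by the mean of \<open>|g|^2 = |f|^q\<close>, and Bernoulli's
  inequality translates this to the coefficients of \<open>f\<close>. A zero \<open>\<alpha>\<close> in the disc is reflected:
  replacing the factor \<open>z - \<alpha>\<close> by \<open>1 - cnj \<alpha> z\<close> keeps \<open>|f|\<close> on the circle and does not decrease
  \<open>|c\<^sub>0|^2 + s |c\<^sub>1|^2\<close>.

  To use this for a Dirichlet polynomial \<open>F\<close> and a prime \<open>p\<close>, one wants to replace \<open>p^(-it)\<close> by an
  independent variable on the circle. The means of \<open>|F|^q\<close> exist and do not change when the
  coefficients are twisted by a unimodular completely multiplicative function
  (\<open>mean_powr_dpoly_twist\<close>): for \<open>|F|^(2k)\<close> this is Parseval's identity applied to \<open>F^k\<close>, and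
  \<open>x^(q/2)\<close> is a uniform limit of polynomials in \<open>x = |F|^2\<close>. The mean of \<open>|F|^q\<close> is therefore also
  the mean of the averages of \<open>|F|^q\<close> over all twists by \<open>z^(v\<^sub>p(n))\<close> with \<open>|z| = 1\<close>. For fixed \<open>t\<close> the
  twisted \<open>F\<close> is a polynomial in \<open>z\<close>, whose coefficients 0 and 1 are the parts \<open>F\<^sub>0\<close>, \<open>F\<^sub>1\<close> of \<open>F\<close> with
  \<open>v\<^sub>p(n) = 0\<close> and \<open>v\<^sub>p(n) = 1\<close>. The one-variable inequality at each \<open>t\<close> followed by Minkowski's
  inequality (\<open>2/q \<ge> 1\<close>) gives \<open>\<parallel>F\<^sub>0\<parallel>\<^sub>q^2 + s \<parallel>F\<^sub>1\<parallel>\<^sub>q^2 \<le> \<parallel>F\<parallel>\<^sub>q^2\<close> (\<open>mean_powr_split_prime\<close>).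

  Splitting in turn along every prime up to \<open>N\<close> leaves parts with a single frequency, whose norms are
  the \<open>|a\<^sub>n|\<close>; the accumulated weight of \<open>n\<close> is \<open>s^\<omega>(n)\<close>, or 0 if a prime divides \<open>n\<close> more than once
  (\<open>weighted_l2_le_mean\<close>).
\<close>

section \<open>The first two coefficients of a polynomial on the unit circle\<close>

text \<open>Cauchy's integral formulas for \<open>g(0)\<close> and \<open>g'(0)\<close> on the circle of radius \<open>r\<close>, read as the
  Fourier coefficients of index 0 and 1 of \<open>g\<close> on that circle.\<close>
lemma circle_mean_value:
  fixes g :: "complex \<Rightarrow> complex" and r :: real
  assumes g: "g holomorphic_on ball 0 1" and r: "0 < r" "r < 1"
  shows "((\<lambda>t. g (r * cis (2*pi*t))) has_integral g 0) {0..1}"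
    and "((\<lambda>t. g (r * cis (2*pi*t)) * cnj (cis (2*pi*t))) has_integral (r * deriv g 0)) {0..1}"
proof -
  have sub: "cball 0 r \<subseteq> ball (0::complex) 1" using r by auto
  have cont: "continuous_on (cball 0 r) g"
    using g sub holomorphic_on_imp_continuous_on continuous_on_subset by blast
  have hol: "g holomorphic_on ball 0 r"
    using g r holomorphic_on_subset[OF g] by (simp add: subset_ball)
  have circ: "circlepath 0 r t = r * cis (2*pi*t)" for t
    by (simp add: circlepath cis_conv_exp mult_ac)
  have hi: "((\<lambda>t. g (r * cis (2*pi*t)) * (r * cis (2*pi*t)) powi (- int k)) 
      has_integral ((deriv ^^ k) g 0 / fact k)) {0..1}" for k
  proof -
    have "((\<lambda>u. g u / (u-0) ^ (Suc k)) has_contour_integral ((2 * pi * \<i>) / (fact k) * (deriv ^^ k) g 0))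
           (circlepath 0 r)"
      using Cauchy_has_contour_integral_higher_derivative_circlepath[OF cont hol, of 0 k] r by simp
    then have "((\<lambda>t. g (circlepath 0 r t) / (circlepath 0 r t) ^ (Suc k) *
         vector_derivative (circlepath 0 r) (at t within {0..1})) has_integral
         ((2 * pi * \<i>) / (fact k) * (deriv ^^ k) g 0)) {0..1}"
      by (simp only: has_contour_integral_def diff_zero)
    then have "((\<lambda>t. 1 / (2*pi*\<i>) * (g (circlepath 0 r t) / (circlepath 0 r t) ^ (Suc k) *
         vector_derivative (circlepath 0 r) (at t within {0..1}))) has_integral
         1 / (2*pi*\<i>) * ((2 * pi * \<i>) / (fact k) * (deriv ^^ k) g 0)) {0..1}"
      by (rule has_integral_mult_right)
    moreover have "1 / (2*pi*\<i>) * ((2 * pi * \<i>) / (fact k) * (deriv ^^ k) g 0) = (deriv ^^ k) g 0 / fact k"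
      by simp
    moreover have "1 / (2*pi*\<i>) * (g (circlepath 0 r t) / (circlepath 0 r t) ^ (Suc k) *
         vector_derivative (circlepath 0 r) (at t within {0..1}))
      = g (r * cis (2*pi*t)) * (r * cis (2*pi*t)) powi (- int k)" if "t \<in> {0..1}" for t
    proof -
      have "vector_derivative (circlepath 0 r) (at t within {0..1}) = 2*pi*\<i> * circlepath 0 r t"
        using that by (simp add: vector_derivative_circlepath01) (simp add: circlepath)
      moreover have "circlepath 0 r t \<noteq> 0" using r by (simp add: circ)
      ultimately show ?thesis unfolding circ[symmetric]
        by (simp add: power_int_minus field_simps)
    qed
    ultimately show ?thesis by (metis (no_types, lifting) has_integral_cong)
  qed
  show "((\<lambda>t. g (r * cis (2*pi*t))) has_integral g 0) {0..1}" using hi[of 0] by simp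
  have "((\<lambda>t. r * (g (r * cis (2*pi*t)) * (r * cis (2*pi*t)) powi (- int 1))) 
      has_integral (r * ((deriv ^^ 1) g 0 / fact 1))) {0..1}"
    using hi[of 1] by (rule has_integral_mult_right)
  moreover have eq: "r * (g (r * cis (2*pi*t)) * (r * cis (2*pi*t)) powi (- int 1)) =
     g (r * cis (2*pi*t)) * cnj (cis (2*pi*t))" for t
    using r by (simp add: power_int_minus cis_inverse cis_cnj)
  ultimately show "((\<lambda>t. g (r * cis (2*pi*t)) * cnj (cis (2*pi*t))) has_integral (r * deriv g 0)) {0..1}"
    unfolding eq by simp
qed

text \<open>Bessel's inequality for the two Fourier coefficients above: expand the mean of
  \<open>|g - b - c e|^2 \<ge> 0\<close>, where \<open>b\<close> and \<open>c\<close> are the coefficients and \<open>e\<close> is the first character.\<close>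
lemma bessel_circle:
  fixes g :: "complex \<Rightarrow> complex" and r :: real
  assumes g: "g holomorphic_on ball 0 1" and r: "0 < r" "r < 1"
  shows "(norm (g 0))\<^sup>2 + r\<^sup>2 * (norm (deriv g 0))\<^sup>2 \<le> integral {0..1} (\<lambda>t. (norm (g (r * cis (2*pi*t))))\<^sup>2)"
proof -
  define h where "h = (\<lambda>t. g (r * cis (2*pi*t)))"
  define e where "e = (\<lambda>t. cis (2*pi*t))"
  define b where "b = g 0"
  define c where "c = r * deriv g 0"
  have ih: "(h has_integral b) {0..1}" and ihe: "((\<lambda>t. h t * cnj (e t)) has_integral c) {0..1}"
    using circle_mean_value[OF g r] by (simp_all add: h_def e_def b_def c_def)
  \<comment> \<open>orthogonality of the characters is the case of a constant function in Cauchy's formula\<close>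
  have ie: "((\<lambda>t. cnj (e t)) has_integral 0) {0..1}"
    using circle_mean_value(2)[of "\<lambda>_. 1", OF _ r] by (simp add: e_def)
  have conth: "continuous_on {0..1} (\<lambda>t. (norm (h t))\<^sup>2)"
    unfolding h_def
    by (intro continuous_intros continuous_on_compose2[OF holomorphic_on_imp_continuous_on[OF g]])
       (use r in \<open>auto simp: norm_mult\<close>)
  have ihh: "((\<lambda>t. (norm (h t))\<^sup>2) has_integral integral {0..1} (\<lambda>t. (norm (h t))\<^sup>2)) {0..1}"
    using integrable_continuous_real[OF conth] by (rule integrable_integral)
  have id: "(norm (h t - b - c * e t))\<^sup>2 = (norm (h t))\<^sup>2 - 2 * Re (cnj b * h t) - 2 * Re (cnj c * (h t * cnj (e t)))
      + 2 * Re (b * cnj c * cnj (e t)) + ((norm b)\<^sup>2 + (norm c)\<^sup>2)" for t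
  proof -
    have e1: "e t * cnj (e t) = 1"
      unfolding e_def by (simp add: cis_cnj cis_mult)
    have "complex_of_real ((norm (h t - b - c * e t))\<^sup>2) = (h t - b - c * e t) * cnj (h t - b - c * e t)"
      by (rule complex_norm_square)
    also have "\<dots> = h t * cnj (h t) - (cnj b * h t + cnj (cnj b * h t)) 
        - (cnj c * (h t * cnj (e t)) + cnj (cnj c * (h t * cnj (e t))))
        + (b * cnj c * cnj (e t) + cnj (b * cnj c * cnj (e t))) + (b * cnj b + c * cnj c * (e t * cnj (e t)))"
      by (simp add: algebra_simps)
    also have "\<dots> = complex_of_real ((norm (h t))\<^sup>2 - 2 * Re (cnj b * h t) - 2 * Re (cnj c * (h t * cnj (e t)))
      + 2 * Re (b * cnj c * cnj (e t)) + ((norm b)\<^sup>2 + (norm c)\<^sup>2))"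
      unfolding e1 by (simp only: complex_add_cnj complex_norm_square of_real_add of_real_diff mult_1_right)
    finally show ?thesis by (simp only: of_real_eq_iff)
  qed
  have lin: "((\<lambda>t. 2 * Re (w * k t)) has_integral 2 * Re (w * y)) {0..1}"
    if "(k has_integral y) {0..1}" for k :: "real \<Rightarrow> complex" and w y
    by (intro has_integral_mult_right has_integral_Re that)
  have const: "((\<lambda>t. (norm b)\<^sup>2 + (norm c)\<^sup>2) has_integral ((norm b)\<^sup>2 + (norm c)\<^sup>2)) {0..1::real}"
    using has_integral_const_real[of "(norm b)\<^sup>2 + (norm c)\<^sup>2" 0 1] by simp
  have "((\<lambda>t. (norm (h t - b - c * e t))\<^sup>2) has_integral
     (integral {0..1} (\<lambda>t. (norm (h t))\<^sup>2) - 2 * Re (cnj b * b) - 2 * Re (cnj c * c) + 2 * Re (b * cnj c * 0) + ((norm b)\<^sup>2 + (norm c)\<^sup>2))) {0..1}"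
    unfolding id
    by (intro has_integral_add has_integral_diff lin ihh ihe ih ie const)
  then have "0 \<le> integral {0..1} (\<lambda>t. (norm (h t))\<^sup>2) - 2 * Re (cnj b * b) - 2 * Re (cnj c * c) + 2 * Re (b * cnj c * 0) + ((norm b)\<^sup>2 + (norm c)\<^sup>2)"
    by (rule has_integral_nonneg) simp
  moreover have "Re (cnj b * b) = (norm b)\<^sup>2" "Re (cnj c * c) = (norm c)\<^sup>2"
    by (simp_all add: cmod_power2 flip: power2_eq_square)
  ultimately show ?thesis
    using r by (simp add: h_def b_def c_def norm_mult power_mult_distrib)
qed

text \<open>Bernoulli's inequality for exponents at most 1, as the weighted mean inequality for \<open>1 + x\<close> and 1.\<close>
lemma bernoulli_powr_concave:
  fixes x s :: real
  assumes "0 \<le> x" "0 < s" "s \<le> 1"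
  shows "(1 + x) powr s \<le> 1 + s * x"
  using Youngs_inequality_0[of s "1 - s" "1 + x" 1] assms by (simp add: algebra_simps)

text \<open>Without zeros in the disc, \<open>f = exp L\<close> there, and \<open>g = exp (s L)\<close> is the holomorphic power \<open>f^s\<close>
  with \<open>s = q/2\<close>, so that \<open>|g|^2 = |f|^q\<close>. With \<open>A = |c\<^sub>0|\<close> and \<open>d = L'(0)\<close>, Bessel's inequality for \<open>g\<close>
  reads \<open>A^q (1 + s^2 |d|^2) \<le> \<parallel>f\<parallel>\<^sub>q^q\<close>, while \<open>c\<^sub>1 = d c\<^sub>0\<close> turns the left-hand side of the claim into
  \<open>A^q (1 + s |d|^2)^s\<close>; Bernoulli's inequality compares the two. Zeros on the circle itself are allowed:
  Bessel's inequality is used on circles of radius \<open>r < 1\<close>, and \<open>r\<close> tends to 1 at the end.\<close>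
lemma zero_free_coeff_bound:
  fixes f :: "complex poly"
  assumes nz: "\<And>z. norm z < 1 \<Longrightarrow> poly f z \<noteq> 0" and q: "0 < q" "q \<le> 2"
  shows "((norm (coeff f 0))\<^sup>2 + q/2 * (norm (coeff f 1))\<^sup>2) powr (q/2)
      \<le> integral {0..1} (\<lambda>t. norm (poly f (cis (2*pi*t))) powr q)"
proof -
  define s where "s = q/2"
  have s: "0 < s" "s \<le> 1" using q by (auto simp: s_def)
  obtain L where L: "L holomorphic_on ball 0 1" and fL: "\<And>z. z \<in> ball 0 1 \<Longrightarrow> poly f z = exp (L z)"
    by (rule contractible_imp_holomorphic_log[of "poly f" "ball 0 1"])
       (use nz in \<open>auto intro!: holomorphic_intros convex_imp_contractible\<close>)
  define g where "g = (\<lambda>z. exp (of_real s * L z))"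
  have g: "g holomorphic_on ball 0 1" unfolding g_def by (intro holomorphic_intros L)
  define d where "d = deriv L 0"
  have dL: "(L has_field_derivative d) (at 0)"
    using holomorphic_derivI[OF L, of 0] by (simp add: d_def)
  have c0: "coeff f 0 = exp (L 0)" using fL[of 0] by (simp add: poly_0_coeff_0)
  have c1: "coeff f 1 = d * exp (L 0)"
  proof -
    have "((\<lambda>z. exp (L z)) has_field_derivative (exp (L 0) * d)) (at 0)"
      by (rule DERIV_fun_exp[OF dL])
    then have "(poly f has_field_derivative (exp (L 0) * d)) (at 0)"
      by (rule has_field_derivative_transform_within_open[of _ _ _ "ball 0 1"]) (auto simp: fL)
    moreover have "(poly f has_field_derivative poly (pderiv f) 0) (at 0)" by (rule poly_DERIV)
    ultimately have "poly (pderiv f) 0 = exp (L 0) * d" by (rule DERIV_unique[rotated])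
    then show ?thesis by (simp add: poly_0_coeff_0 coeff_pderiv)
  qed
  have "(g has_field_derivative (exp (of_real s * L 0) * (of_real s * d))) (at 0)"
    unfolding g_def by (intro DERIV_fun_exp DERIV_cmult dL)
  then have g1: "deriv g 0 = of_real s * d * g 0" by (simp add: DERIV_imp_deriv g_def)
  define A where "A = norm (coeff f 0)"
  have A: "A > 0" by (simp add: A_def c0)
  have ng: "(norm (g z))\<^sup>2 = norm (poly f z) powr q" if "norm z < 1" for z
  proof -
    have "norm (poly f z) powr q = exp (q * Re (L z))"
      using fL[of z] that by (simp add: norm_exp_eq_Re powr_def)
    also have "\<dots> = (exp (s * Re (L z)))\<^sup>2"
      unfolding exp_double[symmetric] by (simp add: s_def)
    also have "\<dots> = (norm (g z))\<^sup>2" by (simp add: g_def norm_exp_eq_Re)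
    finally show ?thesis ..
  qed
  define I where "I = (\<lambda>r::real. integral {0..1} (\<lambda>t. norm (poly f (r * cis (2*pi*t))) powr q))"
  have contI: "continuous_on UNIV I"
    unfolding I_def 
    using q by (intro integral_continuous_on_param[where a="0::real" and b=1, unfolded cbox_interval])
       (auto intro!: continuous_intros continuous_on_powr' simp: case_prod_unfold)
  have ineq: "A powr q * (1 + r\<^sup>2 * (s\<^sup>2 * (norm d)\<^sup>2)) \<le> I r" if r: "0 < r" "r < 1" for r
  proof -
    have "(norm (g 0))\<^sup>2 + r\<^sup>2 * (norm (deriv g 0))\<^sup>2 = (norm (g 0))\<^sup>2 * (1 + r\<^sup>2 * (s\<^sup>2 * (norm d)\<^sup>2))"
      using s by (simp add: g1 norm_mult power_mult_distrib algebra_simps)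
    moreover have "(norm (g 0))\<^sup>2 = A powr q" using ng[of 0] by (simp add: A_def poly_0_coeff_0)
    ultimately have "A powr q * (1 + r\<^sup>2 * (s\<^sup>2 * (norm d)\<^sup>2)) = (norm (g 0))\<^sup>2 + r\<^sup>2 * (norm (deriv g 0))\<^sup>2"
      by simp
    also have "\<dots> \<le> integral {0..1} (\<lambda>t. (norm (g (r * cis (2*pi*t))))\<^sup>2)"
      by (rule bessel_circle[OF g r])
    also have "\<dots> = I r" unfolding I_def
      by (intro integral_cong ng) (use r in \<open>simp add: norm_mult\<close>)
    finally show ?thesis .
  qed
  have "A powr q * (1 + 1\<^sup>2 * (s\<^sup>2 * (norm d)\<^sup>2)) \<le> I 1"
  proof (rule tendsto_le)
    show "at_left (1::real) \<noteq> bot" by simp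
    show "(I \<longlongrightarrow> I 1) (at_left 1)"
      using contI by (simp add: continuous_on_def filterlim_at_split)
    show "((\<lambda>r. A powr q * (1 + r\<^sup>2 * (s\<^sup>2 * (norm d)\<^sup>2))) \<longlongrightarrow> A powr q * (1 + 1\<^sup>2 * (s\<^sup>2 * (norm d)\<^sup>2))) (at_left 1)"
      by (intro tendsto_intros)
    show "\<forall>\<^sub>F r in at_left 1. A powr q * (1 + r\<^sup>2 * (s\<^sup>2 * (norm d)\<^sup>2)) \<le> I r"
      using ineq eventually_at_left_real[of 0 "1::real"] by (auto elim: eventually_mono)
  qed
  moreover have "(A\<^sup>2 + s * (norm (coeff f 1))\<^sup>2) powr s \<le> A powr q * (1 + 1\<^sup>2 * (s\<^sup>2 * (norm d)\<^sup>2))"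
  proof -
    have "A\<^sup>2 + s * (norm (coeff f 1))\<^sup>2 = A\<^sup>2 * (1 + s * (norm d)\<^sup>2)"
      unfolding c1 A_def c0 by (simp add: norm_mult power_mult_distrib algebra_simps)
    then have "(A\<^sup>2 + s * (norm (coeff f 1))\<^sup>2) powr s = (A\<^sup>2) powr s * (1 + s * (norm d)\<^sup>2) powr s"
      using s by (simp add: powr_mult)
    also have "(A\<^sup>2) powr s = A powr q"
    proof -
      have "A\<^sup>2 = A powr 2" using A by simp
      then show ?thesis by (simp only: powr_powr s_def) simp
    qed
    also have "A powr q * (1 + s * (norm d)\<^sup>2) powr s \<le> A powr q * (1 + s * (s * (norm d)\<^sup>2))"
      using s by (intro mult_left_mono bernoulli_powr_concave) auto
    finally show ?thesis by (simp add: power2_eq_square mult.assoc mult_left_mono)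
  qed
  ultimately show ?thesis unfolding A_def s_def I_def by simp
qed

text \<open>If \<open>g\<close> has coefficients \<open>u, v, \<dots>\<close>, the first two coefficients of \<open>(z - \<alpha>) g\<close> are \<open>- \<alpha> u\<close> and
  \<open>u - \<alpha> v\<close>, and those of \<open>(1 - cnj \<alpha> z) g\<close> are \<open>u\<close> and \<open>v - cnj \<alpha> u\<close>. So this lemma says that
  reflecting a zero out of the disc does not decrease \<open>|c\<^sub>0|^2 + s |c\<^sub>1|^2\<close>. The cross terms
  of the two sides agree, which leaves an explicit nonnegative difference.\<close>
lemma reflect_coeff_bound:
  fixes \<alpha> u v :: complex and s :: real
  assumes "norm \<alpha> \<le> 1" "0 \<le> s" "s \<le> 1"
  shows "(norm (- \<alpha> * u))\<^sup>2 + s * (norm (u - \<alpha> * v))\<^sup>2 \<le> (norm u)\<^sup>2 + s * (norm (v - cnj \<alpha> * u))\<^sup>2"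
proof -
  have eq: "((norm u)\<^sup>2 + s * (norm (v - cnj \<alpha> * u))\<^sup>2) - ((norm (- \<alpha> * u))\<^sup>2 + s * (norm (u - \<alpha> * v))\<^sup>2)
     = (1 - (norm \<alpha>)\<^sup>2) * ((1 - s) * (norm u)\<^sup>2 + s * (norm v)\<^sup>2)"
    unfolding cmod_power2 by (simp add: power2_eq_square algebra_simps)
  have "(norm \<alpha>)\<^sup>2 \<le> 1" using assms(1) by (simp add: power_le_one)
  then have "0 \<le> (1 - (norm \<alpha>)\<^sup>2) * ((1 - s) * (norm u)\<^sup>2 + s * (norm v)\<^sup>2)"
    using assms by simp
  then show ?thesis using eq by linarith
qed

lemma norm_reflect_factor:
  assumes "norm (z::complex) = 1"
  shows "norm (1 - cnj \<alpha> * z) = norm (z - \<alpha>)"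
proof -
  have "z * cnj z = 1" using assms by (simp add: complex_norm_square[symmetric])
  then have "1 - cnj \<alpha> * z = z * cnj (z - \<alpha>)" by (simp add: algebra_simps)
  then show ?thesis using assms by (simp only: norm_mult complex_mod_cnj)
qed

text \<open>The zeros of \<open>f\<close> in the disc are reflected one after the other. The zero-free factor \<open>h\<close> collects the
  reflected factors, so the degree of \<open>f\<close> drops in each step although that of the product may not.\<close>
lemma weissler_coeff_bound_times_zero_free:
  fixes f h :: "complex poly"
  assumes q: "0 < q" "q \<le> 2" and h: "\<And>z. norm z < 1 \<Longrightarrow> poly h z \<noteq> 0"
  shows "((norm (coeff (f * h) 0))\<^sup>2 + q/2 * (norm (coeff (f * h) 1))\<^sup>2) powr (q/2)
      \<le> integral {0..1} (\<lambda>t. norm (poly (f * h) (cis (2*pi*t))) powr q)"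
  using h
proof (induction "degree f" arbitrary: f h)
  case 0
  then obtain c where f: "f = [:c:]" by (metis degree_0_id)
  show ?case
  proof (cases "c = 0")
    case True
    then show ?thesis by (simp add: f)
  next
    case False
    then show ?thesis using 0 q by (intro zero_free_coeff_bound) (auto simp: f)
  qed
next
  case (Suc n)
  show ?case
  proof (cases "\<exists>\<alpha>. norm \<alpha> < 1 \<and> poly f \<alpha> = 0")
    case False
    then show ?thesis using Suc.prems q by (intro zero_free_coeff_bound) auto
  next
    case True
    then obtain \<alpha> where \<alpha>: "norm \<alpha> < 1" "poly f \<alpha> = 0" by blast
    then obtain f' where f: "f = [:- \<alpha>, 1:] * f'" by (auto simp: poly_eq_0_iff_dvd)
    have "f' \<noteq> 0" using Suc.hyps(2) f by auto
    then have deg: "n = degree f'" using Suc.hyps(2) unfolding f by (subst (asm) degree_mult_eq) auto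
    define h' where "h' = [:1, - cnj \<alpha>:] * h"
    have h': "poly h' z \<noteq> 0" if "norm z < 1" for z
    proof -
      have "norm (cnj \<alpha> * z) < 1"
        using mult_left_le_one_le[of "norm z" "norm \<alpha>"] \<alpha> that by (simp add: norm_mult)
      then have "1 - cnj \<alpha> * z \<noteq> 0" by auto
      then show ?thesis using Suc.prems[OF that] by (simp add: h'_def algebra_simps)
    qed
    define g where "g = f' * h"
    have fg: "f * h = [:- \<alpha>, 1:] * g" and fg': "f' * h' = [:1, - cnj \<alpha>:] * g"
      by (simp_all only: f h'_def g_def mult_ac)
    have lin: "coeff ([:a, b:] * g) 0 = a * coeff g 0" "coeff ([:a, b:] * g) 1 = a * coeff g 1 + b * coeff g 0" for a b
      by (simp_all add: coeff_pCons)
    have "(norm (coeff (f * h) 0))\<^sup>2 + q/2 * (norm (coeff (f * h) 1))\<^sup>2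
        \<le> (norm (coeff (f' * h') 0))\<^sup>2 + q/2 * (norm (coeff (f' * h') 1))\<^sup>2"
      using reflect_coeff_bound[of \<alpha> "q/2" "coeff g 0" "coeff g 1"] \<alpha> q
      unfolding fg fg' lin by simp
    then have "((norm (coeff (f * h) 0))\<^sup>2 + q/2 * (norm (coeff (f * h) 1))\<^sup>2) powr (q/2)
        \<le> ((norm (coeff (f' * h') 0))\<^sup>2 + q/2 * (norm (coeff (f' * h') 1))\<^sup>2) powr (q/2)"
      using q by (intro powr_mono2) auto
    also have "\<dots> \<le> integral {0..1} (\<lambda>t. norm (poly (f' * h') (cis (2*pi*t))) powr q)"
      by (rule Suc.hyps(1)[OF deg h'])
    also have "\<dots> = integral {0..1} (\<lambda>t. norm (poly (f * h) (cis (2*pi*t))) powr q)"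
    proof -
      have "norm (poly (f' * h') z) = norm (poly (f * h) z)" if "norm z = 1" for z
      proof -
        have "poly (f' * h') z = (1 - cnj \<alpha> * z) * poly g z" "poly (f * h) z = (z - \<alpha>) * poly g z"
          unfolding fg fg' by (simp_all add: algebra_simps)
        then show ?thesis using norm_reflect_factor[OF that, of \<alpha>] by (simp only: norm_mult)
      qed
      then show ?thesis by simp
    qed
    finally show ?thesis .
  qed
qed

lemma weissler_coeff_bound:
  fixes f :: "complex poly"
  assumes q: "0 < q" "q \<le> 2"
  shows "((norm (coeff f 0))\<^sup>2 + q/2 * (norm (coeff f 1))\<^sup>2) powr (q/2)
      \<le> integral {0..1} (\<lambda>t. norm (poly f (cis (2*pi*t))) powr q)"
  using weissler_coeff_bound_times_zero_free[OF q, of 1 f] by simp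

section \<open>Minkowski's inequality for integrals\<close>

text \<open>Hoelder's inequality for two summands with exponents \<open>1/s\<close> and \<open>1/(1-s)\<close>, from Young's inequality
  after normalising by \<open>u + v\<close> and \<open>A + B\<close>. It includes the limiting case \<open>s = 1\<close>.\<close>
lemma two_term_hoelder:
  fixes u v A B s :: real
  assumes "0 \<le> u" "0 \<le> v" "0 \<le> A" "0 \<le> B" "0 < A + B" "0 < s" "s \<le> 1"
  shows "u powr s * A powr (1 - s) + v powr s * B powr (1 - s) \<le> (u + v) powr s * (A + B) powr (1 - s)"
proof (cases "u + v = 0")
  case True
  then show ?thesis using assms by (simp add: add_nonneg_eq_0_iff)
next
  case False
  then have w: "0 < u + v" using assms by simp
  have y: "x powr s * X powr (1 - s) \<le> (s * (x / (u+v)) + (1-s) * (X / (A+B))) * ((u + v) powr s * (A + B) powr (1 - s))"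
    if "0 \<le> x" "0 \<le> X" for x X
  proof (cases "x = 0 \<or> X = 0")
    case True
    then have "x powr s * X powr (1 - s) = 0" by auto
    moreover have "0 \<le> (s * (x / (u+v)) + (1-s) * (X / (A+B))) * ((u + v) powr s * (A + B) powr (1 - s))"
      using that w assms by (intro mult_nonneg_nonneg add_nonneg_nonneg) auto
    ultimately show ?thesis by (simp only:)
  next
    case False
    with that have "0 < x" "0 < X" by auto
    then have "(x / (u+v)) powr s * (X / (A+B)) powr (1-s) \<le> s * (x / (u+v)) + (1-s) * (X / (A+B))"
      using w assms by (intro Youngs_inequality_0) auto
    moreover have "(x / (u+v)) powr s * (X / (A+B)) powr (1-s) = x powr s * X powr (1 - s) / ((u + v) powr s * (A + B) powr (1 - s))"
      using \<open>0 < x\<close> \<open>0 < X\<close> w assms by (simp add: powr_divide)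
    ultimately show ?thesis using w assms by (simp add: pos_divide_le_eq)
  qed
  have "u powr s * A powr (1 - s) + v powr s * B powr (1 - s) \<le>
     (s * (u / (u+v)) + (1-s) * (A / (A+B)) + (s * (v / (u+v)) + (1-s) * (B / (A+B)))) * ((u + v) powr s * (A + B) powr (1 - s))"
    using y[of u A] y[of v B] assms by (simp add: distrib_right)
  also have "s * (u / (u+v)) + (1-s) * (A / (A+B)) + (s * (v / (u+v)) + (1-s) * (B / (A+B))) = s * ((u + v)/(u+v)) + (1-s) * ((A+B)/(A+B))"
    by (simp only: add_divide_distrib distrib_left)
  also have "\<dots> = 1" using w assms by simp
  finally show ?thesis by simp
qed

text \<open>The triangle inequality of the \<open>1/s\<close>-norm on the plane for the integral of the curve
  \<open>(u^s, v^s)\<close>. By duality: pair the curve with the vector \<open>(a^(1-s), b^(1-s))\<close> that norms its integral,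
  and apply Hoelder's inequality at each point.\<close>
lemma minkowski_integral:
  fixes u v :: "real \<Rightarrow> real"
  assumes cu: "continuous_on {0..T} u" and cv: "continuous_on {0..T} v"
    and u0: "\<And>t. 0 \<le> u t" and v0: "\<And>t. 0 \<le> v t" and s: "0 < s" "s \<le> 1"
  shows "((integral {0..T} (\<lambda>t. u t powr s)) powr (1/s) + (integral {0..T} (\<lambda>t. v t powr s)) powr (1/s)) powr s
     \<le> integral {0..T} (\<lambda>t. (u t + v t) powr s)"
proof -
  define A where "A = integral {0..T} (\<lambda>t. u t powr s)"
  define B where "B = integral {0..T} (\<lambda>t. v t powr s)"
  define I where "I = integral {0..T} (\<lambda>t. (u t + v t) powr s)"
  define a where "a = A powr (1/s)"
  define b where "b = B powr (1/s)"
  have cs: "(\<lambda>t. k t powr s) integrable_on {0..T}" if "continuous_on {0..T} k" "\<And>t. 0 \<le> k t" for k :: "real \<Rightarrow> real"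
    using that s by (intro integrable_continuous_real continuous_on_powr') (auto intro: continuous_intros)
  have iu: "(\<lambda>t. u t powr s) integrable_on {0..T}" and iv: "(\<lambda>t. v t powr s) integrable_on {0..T}"
    and iuv: "(\<lambda>t. (u t + v t) powr s) integrable_on {0..T}"
    using cu cv u0 v0 by (auto intro!: cs continuous_intros)
  have A0: "0 \<le> A" and B0: "0 \<le> B" and I0: "0 \<le> I" by (auto simp: A_def B_def I_def intro!: integral_nonneg iu iv iuv)
  have a0: "0 \<le> a" "0 \<le> b" by (simp_all add: a_def b_def)
  have "(a + b) powr s \<le> I"
  proof (cases "a + b = 0")
    case True
    then show ?thesis using I0 by simp
  next
    case False
    then have ab: "0 < a + b" using a0 by simp
    have "(a + b) powr s * (a + b) powr (1 - s) = a + b"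
      using ab by (simp flip: powr_add)
    also have "\<dots> = A * a powr (1 - s) + B * b powr (1 - s)"
    proof -
      have "X powr (1/s) = X * (X powr (1/s)) powr (1-s)" if "0 \<le> X" for X :: real
      proof (cases "X = 0")
        case False
        \<comment> \<open>\<open>b = B^(1/s)\<close> gives \<open>b = B b^(1-s)\<close>, because \<open>1 + (1-s)/s = 1/s\<close>\<close>
        then have "X * (X powr (1/s)) powr (1-s) = X powr 1 * X powr (1/s * (1-s))" using that False by (simp only: powr_powr powr_one)
        also have "\<dots> = X powr (1 + 1/s * (1-s))" by (rule powr_add[symmetric])
        also have "1 + 1/s * (1-s) = 1/s" using s by (simp add: field_simps)
        finally show ?thesis by simp
      qed simp
      then show ?thesis using A0 B0 by (simp add: a_def b_def)
    qed
    also have "\<dots> = integral {0..T} (\<lambda>t. u t powr s * a powr (1 - s) + v t powr s * b powr (1 - s))"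
      unfolding A_def B_def
      by (subst integral_add) (auto intro: integrable_on_mult_left iu iv)
    also have "\<dots> \<le> integral {0..T} (\<lambda>t. (u t + v t) powr s * (a + b) powr (1 - s))"
      using u0 v0 a0 ab s
      by (intro integral_le integrable_add integrable_on_mult_left iu iv iuv two_term_hoelder) auto
    also have "\<dots> = I * (a + b) powr (1 - s)" by (simp add: I_def)
    finally show ?thesis using ab by simp
  qed
  then show ?thesis by (simp add: A_def B_def a_def b_def I_def)
qed

section \<open>Mean values of Dirichlet polynomials\<close>

definition dpoly :: "(nat \<Rightarrow> complex) \<Rightarrow> nat \<Rightarrow> real \<Rightarrow> complex" where
  "dpoly a N t = (\<Sum>n = 1..N. a n * cis (- (t * ln n)))"

lemma dirichlet_poly_eq: "dirichlet_poly a N (\<i> * of_real t) = dpoly a N t"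
  unfolding dirichlet_poly_def dpoly_def
proof (intro sum.cong refl)
  fix n assume "n \<in> {1..N}"
  then have n: "n > 0" by simp
  then have "of_nat n powr (- (\<i> * of_real t)) = exp (- (\<i> * of_real t) * of_real (ln (real n)))"
    by (simp add: powr_def Ln_of_nat)
  also have "\<dots> = cis (- (t * ln n))" by (simp add: cis_conv_exp mult_ac)
  finally show "a n * of_nat n powr (- (\<i> * of_real t)) = a n * cis (- (t * ln n))" by simp
qed

lemma continuous_on_dpoly [continuous_intros]:
  "continuous_on A g \<Longrightarrow> continuous_on A (\<lambda>x. dpoly a N (g x))"
  unfolding dpoly_def by (intro continuous_intros)

lemma norm_dpoly_le: "norm (dpoly a N t) \<le> (\<Sum>n = 1..N. norm (a n))"
  unfolding dpoly_def by (rule order_trans[OF norm_sum]) (simp add: norm_mult)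

text \<open>Stated with scalar multiplication so that it covers complex as well as real functions, since
  Parseval's identity is computed with complex exponentials.\<close>
definition has_mean :: "(real \<Rightarrow> 'a::euclidean_space) \<Rightarrow> 'a \<Rightarrow> bool" where
  "has_mean g L \<longleftrightarrow> ((\<lambda>T. (1 / T) *\<^sub>R integral {0..T} g) \<longlongrightarrow> L) at_top"

lemma has_mean_sum:
  assumes "\<And>i. i \<in> I \<Longrightarrow> has_mean (f i) (L i)" "\<And>i. i \<in> I \<Longrightarrow> continuous_on UNIV (f i)" "finite I"
  shows "has_mean (\<lambda>t. \<Sum>i\<in>I. f i t) (\<Sum>i\<in>I. L i)"
proof -
  have "(1 / T) *\<^sub>R integral {0..T} (\<lambda>t. \<Sum>i\<in>I. f i t) = (\<Sum>i\<in>I. (1 / T) *\<^sub>R integral {0..T} (f i))" for T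
  proof -
    have "integral {0..T} (\<lambda>t. \<Sum>i\<in>I. f i t) = (\<Sum>i\<in>I. integral {0..T} (f i))"
      using assms by (intro integral_sum integrable_continuous_real) (auto intro: continuous_on_subset)
    then show ?thesis by (simp add: scaleR_sum_right)
  qed
  then show ?thesis unfolding has_mean_def using assms(1)
    by (simp only: has_mean_def) (intro tendsto_sum)
qed

lemma has_mean_bounded_linear:
  assumes "bounded_linear h" "has_mean f L" "continuous_on UNIV f"
  shows "has_mean (\<lambda>t. h (f t)) (h L)"
proof -
  have "(1 / T) *\<^sub>R integral {0..T} (\<lambda>t. h (f t)) = h ((1 / T) *\<^sub>R integral {0..T} f)" for T
  proof -
    have "f integrable_on {0..T}"
      using assms(3) by (intro integrable_continuous_real) (auto intro: continuous_on_subset)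
    then have "integral {0..T} (\<lambda>t. h (f t)) = h (integral {0..T} f)"
      using integral_linear[OF _ assms(1)] by (simp add: o_def)
    then show ?thesis by (simp add: linear_cmul[OF bounded_linear.linear[OF assms(1)]])
  qed
  then show ?thesis using assms(2) unfolding has_mean_def
    by (simp only:) (rule bounded_linear.tendsto[OF assms(1)])
qed

lemma has_mean_const: "has_mean (\<lambda>_. c) c"
  unfolding has_mean_def
proof (rule tendsto_eventually)
  show "\<forall>\<^sub>F T in at_top. (1 / T) *\<^sub>R integral {0..T} (\<lambda>_. c) = c"
    using eventually_gt_at_top[of 0] by eventually_elim simp
qed

lemma has_mean_cis:
  assumes "l \<noteq> 0"
  shows "has_mean (\<lambda>t. cis (t * l)) 0"
  unfolding has_mean_def
proof (rule Lim_null_comparison)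
  have int: "((\<lambda>t. cis (t * l)) has_integral (cis (T * l) / (\<i> * l) - cis (0 * l) / (\<i> * l))) {0..T}" if "T > 0" for T
    using that assms
    by (intro fundamental_theorem_of_calculus)
       (auto intro!: derivative_eq_intros has_vector_derivative_real_field simp: cis_conv_exp field_simps)
  show "\<forall>\<^sub>F T in at_top. norm ((1 / T) *\<^sub>R integral {0..T} (\<lambda>t. cis (t * l))) \<le> (1/T) * (2 / \<bar>l\<bar>)"
    using eventually_gt_at_top[of 0]
  proof eventually_elim
    case (elim T)
    have "norm (integral {0..T} (\<lambda>t. cis (t * l))) = norm (cis (T * l) / (\<i> * l) - cis (0 * l) / (\<i> * l))"
      using integral_unique[OF int[OF elim]] by simp
    also have "\<dots> \<le> norm (cis (T * l) / (\<i> * l)) + norm (cis (0 * l) / (\<i> * l))"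
      by (rule norm_triangle_ineq4)
    also have "\<dots> = 2 / \<bar>l\<bar>" by (simp add: norm_divide norm_mult)
    finally have "(1/T) * norm (integral {0..T} (\<lambda>t. cis (t * l))) \<le> (1/T) * (2 / \<bar>l\<bar>)"
      using elim by (intro mult_left_mono) auto
    then show ?case using elim by simp
  qed
  show "((\<lambda>T. (1/T) * (2 / \<bar>l\<bar>)) \<longlongrightarrow> 0) at_top"
    by (rule tendsto_mult_left_zero) (use tendsto_inverse_0_at_top[OF filterlim_ident] in \<open>simp add: inverse_eq_divide\<close>)
qed

lemma has_mean_unique: "has_mean f L \<Longrightarrow> has_mean f L' \<Longrightarrow> L = L'"
  unfolding has_mean_def by (rule tendsto_unique[OF trivial_limit_at_top_linorder])

text \<open>The sequence starts at 1 so that every interval is nondegenerate; dominated convergence is applied to it.\<close>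
lemma has_mean_sequentially:
  "has_mean f L \<Longrightarrow> (\<lambda>n. (1 / real (Suc n)) *\<^sub>R integral {0..real (Suc n)} f) \<longlonglongrightarrow> L"
  unfolding has_mean_def
  by (rule filterlim_compose, assumption)
     (rule filterlim_compose[OF filterlim_real_sequentially filterlim_Suc])

lemma continuous_on_norm_dpoly_powr:
  "0 < q \<Longrightarrow> continuous_on A (\<lambda>t. norm (dpoly a N t) powr q)"
  by (intro continuous_on_powr') (auto intro!: continuous_intros)

lemma has_mean_nonneg:
  assumes "has_mean f (L::real)" "\<And>t. 0 \<le> f t"
  shows "0 \<le> L"
proof (rule tendsto_lowerbound)
  show "((\<lambda>T. (1 / T) *\<^sub>R integral {0..T} f) \<longlongrightarrow> L) at_top" using assms(1) by (simp add: has_mean_def)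
  show "\<forall>\<^sub>F T in at_top. 0 \<le> (1 / T) *\<^sub>R integral {0..T} f"
    using eventually_gt_at_top[of 0]
  proof eventually_elim
    case (elim T)
    have "0 \<le> integral {0..T} f"
      using assms(2) by (cases "f integrable_on {0..T}") (auto intro: integral_nonneg simp: not_integrable_integral)
    then show ?case using elim by simp
  qed
qed simp

text \<open>The frequencies \<open>ln n\<close> are distinct, so only the diagonal terms of \<open>F cnj F\<close> have a nonzero mean.\<close>
lemma parseval_dpoly: "has_mean (\<lambda>t. (norm (dpoly b N t))\<^sup>2) (\<Sum>n = 1..N. (norm (b n))\<^sup>2)"
proof -
  define I where "I = {1..N} \<times> {1..N}"
  define c where "c = (\<lambda>(n,m). b n * cnj (b m))"
  define l where "l = (\<lambda>(n,m). ln (real m) - ln (real n))"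
  have eq: "complex_of_real ((norm (dpoly b N t))\<^sup>2) = (\<Sum>x\<in>I. c x * cis (t * l x))" for t
  proof -
    have "complex_of_real ((norm (dpoly b N t))\<^sup>2) = (\<Sum>x\<in>I. (b (fst x) * cis (- (t * ln (fst x)))) * cnj (b (snd x) * cis (- (t * ln (snd x)))))"
      unfolding complex_norm_square dpoly_def cnj_sum sum_product I_def
      by (subst sum.cartesian_product) (simp add: case_prod_unfold)
    also have "\<dots> = (\<Sum>x\<in>I. c x * cis (t * l x))"
    proof (rule sum.cong[OF refl])
      fix x
      have "cis (- (t * ln (fst x))) * cnj (cis (- (t * ln (snd x)))) = cis (t * l x)"
        by (simp add: cis_cnj cis_mult l_def case_prod_unfold algebra_simps)
      then show "(b (fst x) * cis (- (t * ln (fst x)))) * cnj (b (snd x) * cis (- (t * ln (snd x)))) = c x * cis (t * l x)"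
        by (simp add: c_def case_prod_unfold mult_ac)
    qed
    finally show ?thesis .
  qed
  have m: "has_mean (\<lambda>t. c x * cis (t * l x)) (if fst x = snd x then c x else 0)" if "x \<in> I" for x
  proof (cases "fst x = snd x")
    case True
    then have "l x = 0" by (simp add: l_def case_prod_unfold)
    then show ?thesis using True by (simp add: has_mean_const)
  next
    case False
    then have "l x \<noteq> 0" using that by (auto simp: l_def I_def)
    then have "has_mean (\<lambda>t. c x * cis (t * l x)) (c x * 0)"
      by (intro has_mean_bounded_linear[OF bounded_linear_mult_right] has_mean_cis continuous_intros)
    then show ?thesis using False by simp
  qed
  have "has_mean (\<lambda>t. Re (\<Sum>x\<in>I. c x * cis (t * l x))) (Re (\<Sum>x\<in>I. (if fst x = snd x then c x else 0)))"
    by (intro has_mean_bounded_linear[OF bounded_linear_Re] has_mean_sum m continuous_intros) (auto simp: I_def)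
  moreover have "(\<Sum>x\<in>I. (if fst x = snd x then c x else 0)) = complex_of_real (\<Sum>n = 1..N. (norm (b n))\<^sup>2)"
  proof -
    have "(\<Sum>x\<in>I. (if fst x = snd x then c x else 0)) = (\<Sum>n\<in>{1..N}. \<Sum>m\<in>{1..N}. if n = m then b n * cnj (b m) else 0)"
      unfolding I_def by (subst sum.cartesian_product) (auto intro!: sum.cong simp: case_prod_unfold c_def)
    also have "\<dots> = (\<Sum>n\<in>{1..N}. b n * cnj (b n))" by (intro sum.cong) (auto simp: sum.delta)
    finally show ?thesis by (simp only: of_real_sum complex_norm_square)
  qed
  ultimately show ?thesis by (simp add: eq[symmetric])
qed

text \<open>The value at 0 is left arbitrary because only positive indices occur in a Dirichlet polynomial.\<close>
definition completely_mult :: "(nat \<Rightarrow> complex) \<Rightarrow> bool" where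
  "completely_mult \<psi> \<longleftrightarrow> \<psi> 1 = 1 \<and> (\<forall>m>0. \<forall>n>0. \<psi> (m * n) = \<psi> m * \<psi> n)"

text \<open>The coefficients \<open>b\<close> are the Dirichlet convolution power of \<open>a\<close>. That one \<open>b\<close> serves all \<open>\<psi>\<close>
  is the point: twisting and taking powers commute.\<close>
lemma power_dirichlet_sum:
  "\<exists>b M. \<forall>\<psi>. completely_mult \<psi> \<longrightarrow> (\<Sum>n = 1..N. a n * \<psi> n) ^ k = (\<Sum>n = 1..M. b n * \<psi> n)"
proof (induction k)
  case 0
  show ?case by (rule exI[of _ "\<lambda>_. 1"], rule exI[of _ 1]) (simp add: completely_mult_def)
next
  case (Suc k)
  then obtain b M where bM: "\<And>\<psi>. completely_mult \<psi> \<Longrightarrow> (\<Sum>n = 1..N. a n * \<psi> n) ^ k = (\<Sum>n = 1..M. b n * \<psi> n)"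
    by blast
  define I where "I = {1..N} \<times> {1..M}"
  define d where "d = (\<lambda>l. \<Sum>x\<in>{x\<in>I. fst x * snd x = l}. a (fst x) * b (snd x))"
  have "(\<Sum>n = 1..N. a n * \<psi> n) ^ Suc k = (\<Sum>n = 1..N*M. d n * \<psi> n)" if \<psi>: "completely_mult \<psi>" for \<psi>
  proof -
    have "(\<Sum>n = 1..N. a n * \<psi> n) ^ Suc k = (\<Sum>x\<in>I. (a (fst x) * \<psi> (fst x)) * (b (snd x) * \<psi> (snd x)))"
      unfolding power_Suc bM[OF \<psi>] sum_product I_def by (subst sum.cartesian_product) (simp add: case_prod_unfold)
    also have "\<dots> = (\<Sum>x\<in>I. a (fst x) * b (snd x) * \<psi> (fst x * snd x))"
      using \<psi> by (intro sum.cong) (auto simp: completely_mult_def I_def)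
    also have "\<dots> = (\<Sum>l = 1..N*M. \<Sum>x\<in>{x\<in>I. fst x * snd x = l}. a (fst x) * b (snd x) * \<psi> (fst x * snd x))"
      by (rule sum.group[symmetric]) (auto simp: I_def mult_le_mono)
    also have "\<dots> = (\<Sum>l = 1..N*M. d l * \<psi> l)"
      unfolding d_def sum_distrib_right by (intro sum.cong) auto
    finally show ?thesis .
  qed
  then show ?case by blast
qed

lemma completely_mult_twist:
  assumes "completely_mult \<omega>"
  shows "completely_mult (\<lambda>n. \<omega> n * cis (- (t * ln n)))"
proof -
  have "cis (- (t * ln (real (m * n)))) = cis (- (t * ln m)) * cis (- (t * ln n))" if "m > 0" "n > 0" for m n :: nat
    using that by (simp add: ln_mult cis_mult algebra_simps)
  then show ?thesis using assms by (auto simp: completely_mult_def)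
qed

lemma power_dpoly_twist:
  "\<exists>b M. \<forall>\<omega> t. completely_mult \<omega> \<longrightarrow> dpoly (\<lambda>n. a n * \<omega> n) N t ^ k = dpoly (\<lambda>n. b n * \<omega> n) M t"
proof -
  obtain b M where bM: "\<And>\<psi>. completely_mult \<psi> \<Longrightarrow> (\<Sum>n = 1..N. a n * \<psi> n) ^ k = (\<Sum>n = 1..M. b n * \<psi> n)"
    using power_dirichlet_sum by blast
  show ?thesis
    by (intro exI[of _ b] exI[of _ M] allI impI)
       (use bM[OF completely_mult_twist] in \<open>simp add: dpoly_def mult.assoc\<close>)
qed

text \<open>A Cauchy criterion for a family of functions that have the same limit: approximate limits that are
  shared by the whole family converge to an exact one.\<close>
lemma common_limit:
  fixes \<phi> :: "'i \<Rightarrow> real \<Rightarrow> real"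
  assumes ne: "i0 \<in> X"
    and ap: "\<And>\<epsilon>. \<epsilon> > 0 \<Longrightarrow> \<exists>l. \<forall>i\<in>X. \<forall>\<^sub>F T in at_top. \<bar>\<phi> i T - l\<bar> < \<epsilon>"
  shows "\<exists>L. \<forall>i\<in>X. (\<phi> i \<longlongrightarrow> L) at_top"
proof -
  define e where "e = (\<lambda>k. inverse (real (Suc k)))"
  have e: "e k > 0" for k by (simp add: e_def)
  obtain l where l: "\<And>k i. i \<in> X \<Longrightarrow> \<forall>\<^sub>F T in at_top. \<bar>\<phi> i T - l k\<bar> < e k"
    using ap[OF e] by metis
  have dist: "\<bar>l j - l k\<bar> < e j + e k" for j k
  proof -
    have "\<forall>\<^sub>F T::real in at_top. \<bar>l j - l k\<bar> < e j + e k"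
      using l[OF ne, of j] l[OF ne, of k] by eventually_elim linarith
    then show ?thesis by simp
  qed
  have lim_e: "e \<longlonglongrightarrow> 0" unfolding e_def by (rule LIMSEQ_inverse_real_of_nat)
  have "Cauchy l"
  proof (rule metric_CauchyI)
    fix r :: real assume "r > 0"
    then obtain M where M: "\<And>k. k \<ge> M \<Longrightarrow> e k < r/2"
      using order_tendstoD(2)[OF lim_e, of "r/2"] by (auto simp: eventually_sequentially)
    show "\<exists>M. \<forall>m\<ge>M. \<forall>n\<ge>M. dist (l m) (l n) < r"
    proof (intro exI[of _ M] allI impI)
      fix m n assume "M \<le> m" "M \<le> n"
      then show "dist (l m) (l n) < r" using M[of m] M[of n] dist[of m n] by (simp add: dist_real_def)
    qed
  qed
  then obtain L where L: "l \<longlonglongrightarrow> L" using Cauchy_convergent convergentD by blast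
  have "(\<phi> i \<longlongrightarrow> L) at_top" if i: "i \<in> X" for i
  proof (rule tendstoI)
    fix r :: real assume "r > 0"
    then have "\<forall>\<^sub>F k in sequentially. dist (l k) L < r/2 \<and> e k < r/2"
      using tendstoD[OF L, of "r/2"] order_tendstoD(2)[OF lim_e, of "r/2"] by (simp add: eventually_conj)
    then obtain k where k: "dist (l k) L < r/2" "e k < r/2" by (auto simp: eventually_sequentially)
    show "\<forall>\<^sub>F T in at_top. dist (\<phi> i T) L < r"
      using l[OF i, of k] by eventually_elim (use k in \<open>unfold dist_real_def; linarith\<close>)
  qed
  then show ?thesis by blast
qed

definition unimodular_mult :: "(nat \<Rightarrow> complex) \<Rightarrow> bool" where
  "unimodular_mult \<omega> \<longleftrightarrow> completely_mult \<omega> \<and> (\<forall>n>0. norm (\<omega> n) = 1)"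

lemma unimodular_mult_one: "unimodular_mult (\<lambda>_. 1)"
  by (simp add: unimodular_mult_def completely_mult_def)

lemma unimodular_mult_multiplicity:
  assumes "prime p"
  shows "unimodular_mult (\<lambda>n. cis (2 * pi * x) ^ multiplicity p n)"
  using assms
  by (auto simp: unimodular_mult_def completely_mult_def norm_power power_add prime_elem_multiplicity_mult_distrib)

text \<open>Both the existence of the mean and its invariance under twists. For even exponents \<open>2k\<close> the mean is,
  by Parseval's identity for the \<open>k\<close>-th power, a sum of \<open>|b\<^sub>n|^2\<close>, in which unimodular factors disappear.
  Weierstrass approximation of \<open>x^(q/2)\<close> on the range of \<open>|F|^2\<close>, which has a bound common to all twists,
  gives the general exponent.\<close>
lemma mean_powr_dpoly_twist:
  assumes q: "0 < q"
  shows "\<exists>L. \<forall>\<omega>. unimodular_mult \<omega> \<longrightarrow> has_mean (\<lambda>t. norm (dpoly (\<lambda>n. a n * \<omega> n) N t) powr q) L"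
proof -
  define X where "X = {\<omega>. unimodular_mult \<omega>}"
  define D where "D = (\<lambda>\<omega> t. dpoly (\<lambda>n. a n * \<omega> n) N t)"
  define K where "K = (\<Sum>n = 1..N. norm (a n))"
  have DK: "norm (D \<omega> t) \<le> K" if "\<omega> \<in> X" for \<omega> t
  proof -
    have "norm (D \<omega> t) \<le> (\<Sum>n = 1..N. norm (a n * \<omega> n))" unfolding D_def by (rule norm_dpoly_le)
    also have "\<dots> = K" unfolding K_def using that
      by (intro sum.cong) (auto simp: X_def unimodular_mult_def norm_mult)
    finally show ?thesis .
  qed
  have cD: "continuous_on S (D \<omega>)" for S \<omega> unfolding D_def by (intro continuous_intros)
  have poly: "\<exists>l. \<forall>\<omega>\<in>X. has_mean (\<lambda>t. \<Sum>i\<le>k. c i * ((norm (D \<omega> t))\<^sup>2) ^ i) l" for c and k :: nat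
  proof -
    have "\<exists>l. \<forall>\<omega>\<in>X. has_mean (\<lambda>t. ((norm (D \<omega> t))\<^sup>2) ^ i) l" for i
    proof -
      obtain b M where bM: "\<And>\<omega> t. completely_mult \<omega> \<Longrightarrow> D \<omega> t ^ i = dpoly (\<lambda>n. b n * \<omega> n) M t"
        unfolding D_def using power_dpoly_twist by metis
      have "has_mean (\<lambda>t. ((norm (D \<omega> t))\<^sup>2) ^ i) (\<Sum>n = 1..M. (norm (b n))\<^sup>2)" if "\<omega> \<in> X" for \<omega>
      proof -
        have "((norm (D \<omega> t))\<^sup>2) ^ i = (norm (dpoly (\<lambda>n. b n * \<omega> n) M t))\<^sup>2" for t
        proof -
          have "((norm (D \<omega> t))\<^sup>2) ^ i = (norm (D \<omega> t ^ i))\<^sup>2"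
            by (simp add: norm_power mult.commute flip: power_mult)
          also have "D \<omega> t ^ i = dpoly (\<lambda>n. b n * \<omega> n) M t"
            using that by (intro bM) (simp add: X_def unimodular_mult_def)
          finally show ?thesis .
        qed
        moreover have "(\<Sum>n = 1..M. (norm (b n * \<omega> n))\<^sup>2) = (\<Sum>n = 1..M. (norm (b n))\<^sup>2)"
          using that by (intro sum.cong) (auto simp: X_def unimodular_mult_def norm_mult)
        ultimately show ?thesis using parseval_dpoly[of "\<lambda>n. b n * \<omega> n" M] by simp
      qed
      then show ?thesis by blast
    qed
    then obtain l where l: "\<And>i \<omega>. \<omega> \<in> X \<Longrightarrow> has_mean (\<lambda>t. ((norm (D \<omega> t))\<^sup>2) ^ i) (l i)" by metis
    have "has_mean (\<lambda>t. \<Sum>i\<le>k. c i * ((norm (D \<omega> t))\<^sup>2) ^ i) (\<Sum>i\<le>k. c i * l i)" if "\<omega> \<in> X" for \<omega>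
      by (intro has_mean_sum has_mean_bounded_linear[OF bounded_linear_mult_right] l that continuous_intros cD) auto
    then show ?thesis by blast
  qed
  have "\<exists>L. \<forall>\<omega>\<in>X. ((\<lambda>T. (1 / T) *\<^sub>R integral {0..T} (\<lambda>t. norm (D \<omega> t) powr q)) \<longlongrightarrow> L) at_top"
  proof (rule common_limit)
    show "(\<lambda>_. 1) \<in> X" by (simp add: X_def unimodular_mult_def completely_mult_def)
    fix \<epsilon> :: real assume "\<epsilon> > 0"
    have "continuous_on {0..K\<^sup>2} (\<lambda>x. x powr (q/2))"
      using q by (intro continuous_on_powr') (auto intro: continuous_intros)
    then obtain P where P: "real_polynomial_function P" "\<And>x. x \<in> {0..K\<^sup>2} \<Longrightarrow> \<bar>x powr (q/2) - P x\<bar> < \<epsilon>/2"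
      using Stone_Weierstrass_real_polynomial_function[of "{0..K\<^sup>2}" "\<lambda>x. x powr (q/2)" "\<epsilon>/2"] \<open>\<epsilon> > 0\<close>
      by (metis compact_Icc half_gt_zero)
    from P(1) obtain c k where c: "P = (\<lambda>x. \<Sum>i\<le>k. c i * x ^ i)"
      unfolding real_polynomial_function_iff_sum by blast
    from poly[where c=c and k=k] obtain l where l: "\<And>\<omega>. \<omega> \<in> X \<Longrightarrow> has_mean (\<lambda>t. P ((norm (D \<omega> t))\<^sup>2)) l" 
      unfolding c by blast
    have "\<forall>\<^sub>F T in at_top. \<bar>(1 / T) *\<^sub>R integral {0..T} (\<lambda>t. norm (D \<omega> t) powr q) - l\<bar> < \<epsilon>" if \<omega>: "\<omega> \<in> X" for \<omega>
    proof -
      have cP: "continuous_on S (\<lambda>t. P ((norm (D \<omega> t))\<^sup>2))" for S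
        unfolding c by (intro continuous_intros cD)
      have cQ: "continuous_on S (\<lambda>t. norm (D \<omega> t) powr q)" for S
        using q by (intro continuous_on_powr') (auto intro!: continuous_intros cD)
      have close: "\<bar>norm (D \<omega> t) powr q - P ((norm (D \<omega> t))\<^sup>2)\<bar> \<le> \<epsilon>/2" for t
      proof -
        have "(norm (D \<omega> t))\<^sup>2 \<in> {0..K\<^sup>2}" using DK[OF \<omega>, of t] by (simp add: power_mono)
        moreover have "((norm (D \<omega> t))\<^sup>2) powr (q/2) = norm (D \<omega> t) powr q"
        proof -
          have "(norm (D \<omega> t))\<^sup>2 = norm (D \<omega> t) powr 2" by simp
          then show ?thesis by (simp only: powr_powr) simp
        qed
        ultimately show ?thesis using P(2)[of "(norm (D \<omega> t))\<^sup>2"] by simp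
      qed
      have "\<forall>\<^sub>F T in at_top. \<bar>(1 / T) *\<^sub>R integral {0..T} (\<lambda>t. P ((norm (D \<omega> t))\<^sup>2)) - l\<bar> < \<epsilon>/2"
        using tendstoD[OF l[OF \<omega>, unfolded has_mean_def], of "\<epsilon>/2"] \<open>\<epsilon> > 0\<close>
        unfolding dist_real_def by simp
      then show ?thesis using eventually_gt_at_top[of 0]
      proof eventually_elim
        case (elim T)
        have "\<bar>integral {0..T} (\<lambda>t. norm (D \<omega> t) powr q) - integral {0..T} (\<lambda>t. P ((norm (D \<omega> t))\<^sup>2))\<bar>
           = norm (integral {0..T} (\<lambda>t. norm (D \<omega> t) powr q - P ((norm (D \<omega> t))\<^sup>2)))"
          by (subst integral_diff) (auto intro!: integrable_continuous_real cP cQ)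
        also have "\<dots> \<le> (\<epsilon>/2) * (T - 0)"
          using elim close by (intro integral_bound continuous_intros cP cQ) auto
        finally have "\<bar>(1 / T) *\<^sub>R integral {0..T} (\<lambda>t. norm (D \<omega> t) powr q) - (1 / T) *\<^sub>R integral {0..T} (\<lambda>t. P ((norm (D \<omega> t))\<^sup>2))\<bar> \<le> \<epsilon>/2"
          using elim by (simp add: field_simps abs_le_iff)
        then show ?case using elim by linarith
      qed
    qed
    then show "\<exists>l. \<forall>\<omega>\<in>X. \<forall>\<^sub>F T in at_top. \<bar>(1 / T) *\<^sub>R integral {0..T} (\<lambda>t. norm (D \<omega> t) powr q) - l\<bar> < \<epsilon>"
      by blast
  qed
  then show ?thesis unfolding X_def D_def has_mean_def by blast
qed

section \<open>Splitting off one prime\<close>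

text \<open>Every single twist of the polynomial has the mean \<open>L\<close>, so the average over the circle of the means over
  growing intervals tends to \<open>L\<close> by dominated convergence; Fubini's theorem exchanges the two averages.\<close>
lemma twist_average_tendsto:
  fixes a :: "nat \<Rightarrow> complex"
  assumes p: "prime p" and q: "0 < q"
    and mean: "has_mean (\<lambda>t. norm (dpoly a N t) powr q) L"
  defines "G \<equiv> \<lambda>x t. norm (dpoly (\<lambda>n. a n * cis (2 * pi * x) ^ multiplicity p n) N t) powr q"
  shows "(\<lambda>n. (1 / real (Suc n)) * integral {0..real (Suc n)} (\<lambda>t. integral {0..1} (\<lambda>x. G x t))) \<longlonglongrightarrow> L"
proof -
  have contG: "continuous_on A (\<lambda>(x, t). G x t)" for A
    unfolding G_def dpoly_def case_prod_unfold using q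
    by (intro continuous_on_powr' continuous_intros) auto
  have swap: "integral {0..T} (\<lambda>t. integral {0..1} (\<lambda>x. G x t)) = integral {0..1} (\<lambda>x. integral {0..T} (G x))" for T
    using integral_swap_continuous[of 0 0 1 T G] contG by (simp add: cbox_interval)
  define K where "K = (\<Sum>n = 1..N. norm (a n))"
  have GK: "norm (G x t) \<le> K powr q" for x t
  proof -
    have "norm (dpoly (\<lambda>n. a n * cis (2 * pi * x) ^ multiplicity p n) N t) \<le> K"
      unfolding K_def by (rule order_trans[OF norm_dpoly_le]) (simp add: norm_mult norm_power)
    then show ?thesis using q by (auto simp: G_def intro!: powr_mono2)
  qed
  define \<phi> where "\<phi> = (\<lambda>n x. (1 / real (Suc n)) *\<^sub>R integral {0..real (Suc n)} (G x))"
  have cG: "continuous_on A (G x)" for x A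
    unfolding G_def by (rule continuous_on_norm_dpoly_powr[OF q])
  have "(\<lambda>n. integral {0..1} (\<phi> n)) \<longlonglongrightarrow> integral {0..1} (\<lambda>x::real. L)"
  proof (rule dominated_convergence(2))
    show "\<phi> n integrable_on {0..1}" for n
    proof (intro integrable_continuous_real)
      have "continuous_on {0..1} (\<lambda>x. integral (cbox 0 (real (Suc n))) (G x))"
        by (rule integral_continuous_on_param[OF contG])
      then show "continuous_on {0..1} (\<phi> n)"
        unfolding \<phi>_def cbox_interval by (intro continuous_intros)
    qed
    show "(\<lambda>x. K powr q) integrable_on {0..1::real}" by (rule integrable_const_ivl)
    fix x :: real
    show "norm (\<phi> n x) \<le> K powr q" for n
    proof -
      have "norm (integral {0..real (Suc n)} (G x)) \<le> K powr q * (real (Suc n) - 0)"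
        by (intro integral_bound cG GK) simp
      then show ?thesis by (simp add: \<phi>_def divide_le_eq mult.commute)
    qed
    obtain L' where L': "\<And>\<omega>. unimodular_mult \<omega> \<Longrightarrow> has_mean (\<lambda>t. norm (dpoly (\<lambda>n. a n * \<omega> n) N t) powr q) L'"
      using mean_powr_dpoly_twist[OF q] by blast
    have "L' = L" using has_mean_unique[OF L'[OF unimodular_mult_one]] mean by simp
    then have "has_mean (G x) L"
      using L'[OF unimodular_mult_multiplicity[OF p, of x]] by (simp add: G_def)
    then show "(\<lambda>n. \<phi> n x) \<longlonglongrightarrow> L" unfolding \<phi>_def by (rule has_mean_sequentially)
  qed
  moreover have "integral {0..1} (\<phi> n) = (1 / real (Suc n)) * integral {0..real (Suc n)} (\<lambda>t. integral {0..1} (\<lambda>x. G x t))" for n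
    unfolding swap \<phi>_def by simp
  ultimately show ?thesis by simp
qed

text \<open>For fixed \<open>t\<close>, the twists by \<open>z^(v\<^sub>p(n))\<close> form a polynomial in \<open>z\<close> with coefficients 0 and 1 equal to
  the values of the two parts of the Dirichlet polynomial at \<open>t\<close>. The one-variable inequality is applied
  for each \<open>t\<close>, then Minkowski's inequality on each interval \<open>[0, T]\<close>, and only then \<open>T\<close> tends to infinity.\<close>
lemma mean_powr_split_prime:
  fixes a :: "nat \<Rightarrow> complex"
  assumes p: "prime p" and q: "0 < q" "q \<le> 2"
  defines "a0 \<equiv> \<lambda>n. if multiplicity p n = 0 then a n else 0"
    and "a1 \<equiv> \<lambda>n. if multiplicity p n = 1 then a n else 0"
  assumes L: "has_mean (\<lambda>t. norm (dpoly a N t) powr q) L"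
    and L0: "has_mean (\<lambda>t. norm (dpoly a0 N t) powr q) L0"
    and L1: "has_mean (\<lambda>t. norm (dpoly a1 N t) powr q) L1"
  shows "L0 powr (2/q) + q/2 * L1 powr (2/q) \<le> L powr (2/q)"
proof -
  define s where "s = q/2"
  have s: "0 < s" "s \<le> 1" "2/q = 1/s" "q/2 = s" "q = 2 * s" using q by (auto simp: s_def)
  have pos: "0 \<le> L" "0 \<le> L0" "0 \<le> L1" using L L0 L1 by (auto intro: has_mean_nonneg)
  define u where "u = (\<lambda>t. (norm (dpoly a0 N t))\<^sup>2)"
  define v where "v = (\<lambda>t. s * (norm (dpoly a1 N t))\<^sup>2)"
  define G where "G = (\<lambda>x t. norm (dpoly (\<lambda>n. a n * cis (2 * pi * x) ^ multiplicity p n) N t) powr q)"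
  have sq: "(x\<^sup>2) powr s = x powr q" if "0 \<le> x" for x :: real
  proof -
    have "x\<^sup>2 = x powr 2" using that by simp
    then show ?thesis by (simp only: powr_powr s(5))
  qed
  have pointwise: "(u t + v t) powr s \<le> integral {0..1} (\<lambda>x. G x t)" for t
  proof -
    \<comment> \<open>the twisted polynomial at \<open>t\<close>, with the twist \<open>z\<close> as its variable\<close>
    define f where "f = (\<Sum>n = 1..N. monom (a n * cis (- (t * ln n))) (multiplicity p n))"
    have "coeff f 0 = dpoly a0 N t" "coeff f 1 = dpoly a1 N t"
      unfolding f_def dpoly_def a0_def a1_def coeff_sum by (auto intro!: sum.cong simp: coeff_monom)
    moreover have "poly f (cis (2*pi*x)) = dpoly (\<lambda>n. a n * cis (2 * pi * x) ^ multiplicity p n) N t" for x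
      unfolding f_def dpoly_def poly_sum by (intro sum.cong) (auto simp: poly_monom)
    ultimately show ?thesis
      using weissler_coeff_bound[OF q, of f] by (simp add: u_def v_def G_def s(4))
  qed
  have cu: "continuous_on A u" and cv: "continuous_on A v" for A
    unfolding u_def v_def by (intro continuous_intros)+
  have contG: "continuous_on A (\<lambda>(t, x). G x t)" for A
    unfolding G_def dpoly_def case_prod_unfold using q
    by (intro continuous_on_powr' continuous_intros) auto
  have finite_T: "((1/T * integral {0..T} (\<lambda>t. norm (dpoly a0 N t) powr q)) powr (1/s)
        + s * (1/T * integral {0..T} (\<lambda>t. norm (dpoly a1 N t) powr q)) powr (1/s)) powr s
      \<le> 1/T * integral {0..T} (\<lambda>t. integral {0..1} (\<lambda>x. G x t))" if T: "T > 0" for T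
  proof -
    define A where "A = integral {0..T} (\<lambda>t. norm (dpoly a0 N t) powr q)"
    define B where "B = integral {0..T} (\<lambda>t. norm (dpoly a1 N t) powr q)"
    have nn: "0 \<le> A" "0 \<le> B" unfolding A_def B_def
      using q by (auto intro!: integral_nonneg integrable_continuous_real continuous_on_norm_dpoly_powr)
    have A: "integral {0..T} (\<lambda>t. u t powr s) = A" by (simp add: A_def u_def sq)
    have "integral {0..T} (\<lambda>t. v t powr s) = s powr s * B"
      using s by (simp add: B_def v_def powr_mult sq)
    then have B: "(integral {0..T} (\<lambda>t. v t powr s)) powr (1/s) = s * B powr (1/s)"
      using s nn by (simp add: powr_mult powr_powr)
    have "(A powr (1/s) + s * B powr (1/s)) powr s \<le> integral {0..T} (\<lambda>t. (u t + v t) powr s)"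
      using minkowski_integral[OF cu cv _ _ s(1,2), of T] s unfolding A B by (simp add: u_def v_def)
    also have "\<dots> \<le> integral {0..T} (\<lambda>t. integral {0..1} (\<lambda>x. G x t))"
    proof (rule integral_le)
      show "(\<lambda>t. (u t + v t) powr s) integrable_on {0..T}"
        using s by (intro integrable_continuous_real continuous_on_powr')
          (auto intro!: continuous_intros cu cv simp: u_def v_def)
      have "continuous_on {0..T} (\<lambda>t. integral (cbox 0 1) (\<lambda>x. G x t))"
        by (rule integral_continuous_on_param[OF contG])
      then show "(\<lambda>t. integral {0..1} (\<lambda>x. G x t)) integrable_on {0..T}"
        unfolding cbox_interval by (rule integrable_continuous_real)
    qed (rule pointwise)
    finally have "1/T * (A powr (1/s) + s * B powr (1/s)) powr s \<le> 1/T * integral {0..T} (\<lambda>t. integral {0..1} (\<lambda>x. G x t))"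
      using T by (intro mult_left_mono) auto
    moreover have "1/T * (A powr (1/s) + s * B powr (1/s)) powr s
      = ((1/T * A) powr (1/s) + s * (1/T * B) powr (1/s)) powr s"
    proof -
      have "(1/T * A) powr (1/s) + s * (1/T * B) powr (1/s) = (1/T) powr (1/s) * (A powr (1/s) + s * B powr (1/s))"
        using T nn unfolding powr_mult by (simp only: distrib_left mult_ac)
      moreover have "((1/T) powr (1/s) * X) powr s = 1/T * X powr s" for X
        using T s unfolding powr_mult powr_powr by simp
      ultimately show ?thesis by simp
    qed
    ultimately show ?thesis by (simp add: A_def B_def)
  qed
  have "(L0 powr (1/s) + s * L1 powr (1/s)) powr s \<le> L"
  proof (rule LIMSEQ_le)
    show "(\<lambda>n. (1 / real (Suc n)) * integral {0..real (Suc n)} (\<lambda>t. integral {0..1} (\<lambda>x. G x t))) \<longlonglongrightarrow> L"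
      unfolding G_def by (rule twist_average_tendsto[OF p q(1) L])
    show "(\<lambda>n. ((1 / real (Suc n) * integral {0..real (Suc n)} (\<lambda>t. norm (dpoly a0 N t) powr q)) powr (1/s)
        + s * (1 / real (Suc n) * integral {0..real (Suc n)} (\<lambda>t. norm (dpoly a1 N t) powr q)) powr (1/s)) powr s)
        \<longlonglongrightarrow> (L0 powr (1/s) + s * L1 powr (1/s)) powr s"
    proof (intro tendsto_powr' tendsto_add tendsto_mult tendsto_const)
      show "(\<lambda>n. 1 / real (Suc n) * integral {0..real (Suc n)} (\<lambda>t. norm (dpoly a0 N t) powr q)) \<longlonglongrightarrow> L0"
        using has_mean_sequentially[OF L0] by simp
      show "(\<lambda>n. 1 / real (Suc n) * integral {0..real (Suc n)} (\<lambda>t. norm (dpoly a1 N t) powr q)) \<longlonglongrightarrow> L1"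
        using has_mean_sequentially[OF L1] by simp
    qed (use s q in \<open>auto intro!: always_eventually divide_nonneg_nonneg integral_nonneg integrable_continuous_real continuous_on_norm_dpoly_powr\<close>)
    show "\<exists>N0. \<forall>n\<ge>N0. ((1 / real (Suc n) * integral {0..real (Suc n)} (\<lambda>t. norm (dpoly a0 N t) powr q)) powr (1/s)
        + s * (1 / real (Suc n) * integral {0..real (Suc n)} (\<lambda>t. norm (dpoly a1 N t) powr q)) powr (1/s)) powr s
       \<le> (1 / real (Suc n)) * integral {0..real (Suc n)} (\<lambda>t. integral {0..1} (\<lambda>x. G x t))"
      by (intro exI[of _ 0] allI impI finite_T) simp
  qed
  then have "((L0 powr (1/s) + s * L1 powr (1/s)) powr s) powr (1/s) \<le> L powr (1/s)"
    using s by (intro powr_mono2) auto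
  then have "(L0 powr (1/s) + s * L1 powr (1/s)) \<le> L powr (1/s)"
    using s by (simp add: powr_powr)
  then show ?thesis by (simp add: s)
qed

section \<open>The weights\<close>

text \<open>The factor that splitting along a prime assigns to an index in which this prime has exponent \<open>k\<close>:
  the coefficients of degree 2 and higher are discarded.\<close>
definition prime_weight :: "real \<Rightarrow> nat \<Rightarrow> real" where
  "prime_weight s k = (if k = 0 then 1 else if k = 1 then s else 0)"

text \<open>A divisor of a squarefree number is determined by its set of prime factors, which can be any subset.\<close>
lemma num_divisors_squarefree:
  assumes "squarefree n" "n > 0"
  shows "num_divisors n = 2 ^ card (prime_factors n)"
proof -
  have pf: "prime_factors (\<Prod>A) = A" "\<Prod>A dvd n" if "A \<subseteq> prime_factors n" for A
  proof -
    have fin: "finite A" using that by (rule finite_subset) simp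
    have pr: "prime_factorization (\<Prod>A) = mset_set A"
    proof (rule prime_factorization_eqI)
      show "normalize (prod_mset (mset_set A)) = normalize (\<Prod>A)"
        by (simp add: prod_unfold_prod_mset)
    qed (use that fin in auto)
    then show "prime_factors (\<Prod>A) = A" using fin by simp
    have nz: "\<Prod>A \<noteq> 0" using that fin by (auto simp: prime_gt_0_nat)
    have "mset_set A \<subseteq># prime_factorization n"
      using subset_imp_msubset_mset_set[OF that] mset_set_set_mset_msubset[of "prime_factorization n"]
      by (auto intro: subset_mset.order_trans)
    then show "\<Prod>A dvd n" using pr nz assms(2) by (simp flip: prime_factorization_subset_iff_dvd)
  qed
  have "bij_betw prime_factors {d. d dvd n} (Pow (prime_factors n))"
    unfolding bij_betw_def
  proof
    show "inj_on prime_factors {d. d dvd n}"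
    proof (rule inj_onI)
      fix d e assume de: "d \<in> {d. d dvd n}" "e \<in> {d. d dvd n}" and eq: "prime_factors d = prime_factors e"
      then have sq: "squarefree d" "squarefree e" and nz: "d \<noteq> 0" "e \<noteq> 0"
        using assms squarefree_mono by auto
      have id: "x = \<Prod>(prime_factors x)" if "squarefree x" "x \<noteq> 0" for x :: nat
      proof -
        have "x = (\<Prod>p \<in> prime_factors x. p ^ multiplicity p x)"
          using that by (intro prime_factorization_nat) simp
        also have "\<dots> = (\<Prod>p \<in> prime_factors x. p)"
          using that by (intro prod.cong) (auto simp: squarefree_factorial_semiring')
        finally show ?thesis .
      qed
      have "d = \<Prod>(prime_factors d)" by (rule id[OF sq(1) nz(1)])
      also have "\<dots> = e" unfolding eq by (rule id[OF sq(2) nz(2), symmetric])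
      finally show "d = e" .
    qed
    show "prime_factors ` {d. d dvd n} = Pow (prime_factors n)"
    proof
      show "prime_factors ` {d. d dvd n} \<subseteq> Pow (prime_factors n)"
        using assms(2) by (intro image_subsetI PowI dvd_prime_factors) auto
      show "Pow (prime_factors n) \<subseteq> prime_factors ` {d. d dvd n}"
      proof
        fix A assume "A \<in> Pow (prime_factors n)"
        then show "A \<in> prime_factors ` {d. d dvd n}"
          using pf[of A] by (intro image_eqI[of _ _ "\<Prod>A"]) auto
      qed
    qed
  qed
  then have "card {d. d dvd n} = card (Pow (prime_factors n))" by (rule bij_betw_same_card)
  then show ?thesis by (simp add: num_divisors_def card_Pow)
qed

text \<open>The exponent \<open>log q / log 2 - 1\<close> is the power to which 2 must be raised to give \<open>q/2\<close>.\<close>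
lemma squarefree_weight_eq:
  assumes q: "0 < q" and n: "0 < n" "n \<le> N"
  shows "of_int \<bar>moebius_mu n\<bar> * real (num_divisors n) powr (ln q / ln 2 - 1)
     = (\<Prod>p | prime p \<and> p \<le> N. prime_weight (q/2) (multiplicity p n))"
proof (cases "squarefree n")
  case True
  have "(\<Prod>p | prime p \<and> p \<le> N. prime_weight (q/2) (multiplicity p n)) =
     (\<Prod>p \<in> prime_factors n. prime_weight (q/2) (multiplicity p n))"
  proof (rule prod.mono_neutral_right)
    show "prime_factors n \<subseteq> {p. prime p \<and> p \<le> N}" using n by (auto simp: in_prime_factors_iff intro: order_trans[OF dvd_imp_le])
  qed (use n in \<open>auto simp: prime_weight_def prime_factors_multiplicity\<close>)
  also have "\<dots> = (\<Prod>p \<in> prime_factors n. q/2)"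
    using True n by (intro prod.cong) (auto simp: prime_weight_def squarefree_factorial_semiring')
  also have "\<dots> = (2 powr (ln q / ln 2 - 1)) ^ card (prime_factors n)"
    using q by (simp add: powr_diff) (simp add: powr_def)
  also have "\<dots> = real (num_divisors n) powr (ln q / ln 2 - 1)"
  proof -
    have "(2 powr x) ^ k = real (2 ^ k) powr x" for x k
    proof -
      have "real (2 ^ k) powr x = (2 powr real k) powr x" by (simp add: powr_realpow)
      also have "\<dots> = 2 powr (x * real k)" by (simp only: powr_powr mult.commute)
      also have "\<dots> = (2 powr x) powr real k" by (simp only: powr_powr)
      also have "\<dots> = (2 powr x) ^ k" by (rule powr_realpow) simp
      finally show ?thesis by (rule sym)
    qed
    then show ?thesis by (simp only: num_divisors_squarefree[OF True n(1)])
  qed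
  finally show ?thesis using True by (simp add: moebius_mu_def power_abs)
next
  case False
  then obtain p where "prime p" "p\<^sup>2 dvd n"
    using n squarefree_factorial_semiring[of n] by blast
  then have p: "prime p" "multiplicity p n \<ge> 2"
    using n by (auto simp: not_prime_unit intro: multiplicity_geI[of n p 2])
  have "p dvd n" using p(2) not_dvd_imp_multiplicity_0[of p n] by (cases "p dvd n") simp_all
  then have "p \<le> N" using n dvd_imp_le[of p n] by simp
  then have "(\<Prod>p | prime p \<and> p \<le> N. prime_weight (q/2) (multiplicity p n)) = 0"
    using p \<open>p \<le> N\<close> by (intro prod_zero bexI[of _ p]) (auto simp: prime_weight_def)
  then show ?thesis using False by (simp add: moebius_mu_def)
qed

section \<open>Splitting off all primes\<close>

text \<open>Induction over the set of primes along which the polynomial is split. The hypothesis on \<open>a\<close> says that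
  the primes of \<open>S\<close> separate the indices in the support. Restricting the coefficients to a fixed exponent of
  \<open>p\<close> makes \<open>p\<close> dispensable for this, and when no prime is left the support has at most one index.\<close>
lemma weighted_l2_le_mean:
  fixes a :: "nat \<Rightarrow> complex"
  assumes "finite S" "\<And>p. p \<in> S \<Longrightarrow> prime p" and q: "0 < q" "q \<le> 2"
    and "\<And>m n. m \<in> {1..N} \<Longrightarrow> n \<in> {1..N} \<Longrightarrow> a m \<noteq> 0 \<Longrightarrow> a n \<noteq> 0 \<Longrightarrow>
        (\<And>p. p \<in> S \<Longrightarrow> multiplicity p m = multiplicity p n) \<Longrightarrow> m = n"
    and "has_mean (\<lambda>t. norm (dpoly a N t) powr q) L"
  shows "(\<Sum>n = 1..N. (\<Prod>p\<in>S. prime_weight (q/2) (multiplicity p n)) * (norm (a n))\<^sup>2) \<le> L powr (2/q)"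
  using assms(1,2,5,6)
proof (induction S arbitrary: a L rule: finite_induct)
  case empty
  show ?case
  proof (cases "\<exists>m\<in>{1..N}. a m \<noteq> 0")
    case False
    then have "(\<Sum>n = 1..N. (norm (a n))\<^sup>2) = 0" by (intro sum.neutral) auto
    then show ?thesis by simp
  next
    case True
    then obtain m where m: "m \<in> {1..N}" "a m \<noteq> 0" by blast
    have zero: "a n = 0" if "n \<in> {1..N} - {m}" for n
      using empty.prems(2)[of n m] m that by auto
    have "(\<Sum>n = 1..N. (norm (a n))\<^sup>2) = (\<Sum>n\<in>{m}. (norm (a n))\<^sup>2)"
      using m zero by (intro sum.mono_neutral_right) auto
    moreover have "dpoly a N t = (\<Sum>n\<in>{m}. a n * cis (- (t * ln n)))" for t
      unfolding dpoly_def using m zero by (intro sum.mono_neutral_right) auto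
    then have "norm (dpoly a N t) powr q = norm (a m) powr q" for t by (simp add: norm_mult)
    then have "has_mean (\<lambda>_. norm (a m) powr q) L" using empty.prems(3) by simp
    then have "L = norm (a m) powr q" by (rule has_mean_unique[OF _ has_mean_const])
    then have "L powr (2/q) = (norm (a m))\<^sup>2"
      using q by (simp add: powr_powr)
    ultimately show ?thesis by simp
  qed
next
  case (insert p S)
  define a0 where "a0 = (\<lambda>n. if multiplicity p n = 0 then a n else 0)"
  define a1 where "a1 = (\<lambda>n. if multiplicity p n = 1 then a n else 0)"
  define w where "w = (\<lambda>n. \<Prod>p\<in>S. prime_weight (q/2) (multiplicity p n))"
  have ex: "\<exists>L. has_mean (\<lambda>t. norm (dpoly b N t) powr q) L" for b
    using mean_powr_dpoly_twist[OF q(1), of b N] unimodular_mult_one by force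
  obtain L0 where L0: "has_mean (\<lambda>t. norm (dpoly a0 N t) powr q) L0" using ex by blast
  obtain L1 where L1: "has_mean (\<lambda>t. norm (dpoly a1 N t) powr q) L1" using ex by blast
  have p: "prime p" using insert.prems(1) by simp
  have "(\<Sum>n = 1..N. (\<Prod>p\<in>insert p S. prime_weight (q/2) (multiplicity p n)) * (norm (a n))\<^sup>2)
      = (\<Sum>n = 1..N. w n * (norm (a0 n))\<^sup>2 + q/2 * (w n * (norm (a1 n))\<^sup>2))"
    using insert.hyps by (intro sum.cong) (auto simp: w_def a0_def a1_def prime_weight_def)
  also have "\<dots> = (\<Sum>n = 1..N. w n * (norm (a0 n))\<^sup>2) + q/2 * (\<Sum>n = 1..N. w n * (norm (a1 n))\<^sup>2)"
    by (simp only: sum.distrib sum_distrib_left)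
  also have "\<dots> \<le> L0 powr (2/q) + q/2 * L1 powr (2/q)"
  proof (intro add_mono mult_left_mono)
    show "(\<Sum>n = 1..N. w n * (norm (a0 n))\<^sup>2) \<le> L0 powr (2/q)"
      unfolding w_def
    proof (rule insert.IH[OF _ _ L0])
      fix m n assume mn: "m \<in> {1..N}" "n \<in> {1..N}" "a0 m \<noteq> 0" "a0 n \<noteq> 0"
        "\<And>r. r \<in> S \<Longrightarrow> multiplicity r m = multiplicity r n"
      then show "m = n"
        by (intro insert.prems(2)[of m n]) (auto simp: a0_def split: if_splits)
    qed (use insert.prems(1) in auto)
    show "(\<Sum>n = 1..N. w n * (norm (a1 n))\<^sup>2) \<le> L1 powr (2/q)"
      unfolding w_def
    proof (rule insert.IH[OF _ _ L1])
      fix m n assume mn: "m \<in> {1..N}" "n \<in> {1..N}" "a1 m \<noteq> 0" "a1 n \<noteq> 0"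
        "\<And>r. r \<in> S \<Longrightarrow> multiplicity r m = multiplicity r n"
      then show "m = n"
        by (intro insert.prems(2)[of m n]) (auto simp: a1_def split: if_splits)
    qed (use insert.prems(1) in auto)
  qed (use q in auto)
  also have "\<dots> \<le> L powr (2/q)"
    using mean_powr_split_prime[OF p q insert.prems(3)] L0 L1 unfolding a0_def a1_def by blast
  finally show ?case .
qed

theorem theorem2:
  fixes a :: "nat \<Rightarrow> complex" and N :: nat and q :: real
  assumes "0 < q" and "q \<le> 2"
  shows "sqrt (\<Sum>n = 1..N. of_int \<bar>moebius_mu n\<bar> * (norm (a n))\<^sup>2
             * real (num_divisors n) powr (ln q / ln 2 - 1))
           \<le> Lq_norm q (dirichlet_poly a N)"
proof -
  define S where "S = {p. prime p \<and> p \<le> N}"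
  obtain L where L: "has_mean (\<lambda>t. norm (dpoly a N t) powr q) L"
    using mean_powr_dpoly_twist[OF assms(1), of a N] unimodular_mult_one by force
  have L0: "0 \<le> L" using L by (rule has_mean_nonneg) simp
  have norm_eq: "Lq_norm q (dirichlet_poly a N) = L powr (1/q)"
    using L unfolding Lq_norm_def has_mean_def dirichlet_poly_eq
    by (simp add: tendsto_Lim)
  have "(\<Sum>n = 1..N. (\<Prod>p\<in>S. prime_weight (q/2) (multiplicity p n)) * (norm (a n))\<^sup>2) \<le> L powr (2/q)"
  proof (rule weighted_l2_le_mean[OF _ _ assms _ L])
    fix m n assume mn: "m \<in> {1..N}" "n \<in> {1..N}" "\<And>p. p \<in> S \<Longrightarrow> multiplicity p m = multiplicity p n"
    have "multiplicity p m = multiplicity p n" if "prime p" for p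
    proof (cases "p \<le> N")
      case True
      then show ?thesis using mn(3) that by (simp add: S_def)
    next
      case False
      then have "\<not> p dvd m" "\<not> p dvd n" using mn(1,2) by (auto dest: dvd_imp_le)
      then show ?thesis by (simp add: not_dvd_imp_multiplicity_0)
    qed
    moreover have "0 < m" "0 < n" using mn(1,2) by simp_all
    ultimately show "m = n" by (rule multiplicity_eq_nat[rotated 2])
  qed (simp_all add: S_def)
  also have "(\<Sum>n = 1..N. (\<Prod>p\<in>S. prime_weight (q/2) (multiplicity p n)) * (norm (a n))\<^sup>2) =
     (\<Sum>n = 1..N. of_int \<bar>moebius_mu n\<bar> * (norm (a n))\<^sup>2 * real (num_divisors n) powr (ln q / ln 2 - 1))"
  proof (intro sum.cong refl)
    fix n assume "n \<in> {1..N}"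
    then have "(\<Prod>p\<in>S. prime_weight (q/2) (multiplicity p n))
      = of_int \<bar>moebius_mu n\<bar> * real (num_divisors n) powr (ln q / ln 2 - 1)"
      unfolding S_def by (intro squarefree_weight_eq[OF assms(1), symmetric]) simp_all
    then show "(\<Prod>p\<in>S. prime_weight (q/2) (multiplicity p n)) * (norm (a n))\<^sup>2
      = of_int \<bar>moebius_mu n\<bar> * (norm (a n))\<^sup>2 * real (num_divisors n) powr (ln q / ln 2 - 1)"
      by (simp only: mult_ac)
  qed
  also have "L powr (2/q) = (L powr (1/q))\<^sup>2"
  proof -
    have "(L powr (1/q))\<^sup>2 = (L powr (1/q)) powr 2" by simp
    then show ?thesis by (simp only: powr_powr) simp
  qed
  finally show ?thesis unfolding norm_eq by (rule real_le_lsqrt[rotated]) simp_all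
qed

end
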